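(* Let $G\in\mathbb{GS}$ with $Ls(G)<Rs(G)$. Then $G$ is not invertible, i.e. there is no $H\in\mathbb{GS}$ with $G+H\sim 0$.
   Context: A scoring game is written $G=\langle G^{\mathcal L}\mid G^{\mathcal R}\rangle$, where each of $G^{\mathcal L}$ (Left options) and $G^{\mathcal R}$ (Right options) is either a finite nonempty set of scoring games or an atom $\emptyset^{s}$, $s\in\mathbb R$ (the player to move on that side cannot move and the game ends with score $s$); game trees are finite. An atom occurring in $G$ is an atom of $G$ or of any follower of $G$. $G$ is guaranteed if for every follower $K$ of $G$: if $K^{\mathcal L}=\emptyset^\ell$ then $\ell\le s$ for every atom $\emptyset^s$ occurring in $K$, and if $K^{\mathcal R}=\emptyset^r$ then $s\le r$ for every atom $\emptyset^s$ occurring in $K$; $\mathbb{GS}$ is the class of guaranteed games. Disjunctive sum $G+H$: Left options are $G^L+H$ and $G+H^L$, except if both are left-atomic with atoms $\emptyset^{\ell_1},\emptyset^{\ell_2}$, then $(G+H)^{\mathcal L}=\emptyset^{\ell_1+\ell_2}$; Right symmetric. Stops: $Ls(G)=\ell$ if $G^{\mathcal L}=\emptyset^\ell$, otherwise $\max_{G^L}Rs(G^L)$; $Rs(G)=r$ if $G^{\mathcal R}=\emptyset^r$, otherwise $\min_{G^R}Ls(G^R)$. $G\succcurlyeq H$ iff $Ls(G+X)\ge Ls(H+X)$ and $Rs(G+X)\ge Rs(H+X)$ for all $X\in\mathbb{GS}$; $G\sim H$ iff both $G\succcurlyeq H$ and $H\succcurlyeq G$. $0=\langle\emptyset^0\mid\emptyset^0\rangle$.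 *)

theory Defs
  imports Complex_Main "HOL-Library.FSet"
begin

text \<open>
  A side \<open>Atom s\<close> is the atom \<open>\<emptyset>\<^sup>s\<close>. The datatype also contains the junk value
  \<open>Options {||}\<close>; the predicate \<open>scoring_game\<close> below rules it out hereditarily.
\<close>

datatype game = Game (left_side: side) (right_side: side)
  and side = Atom real | Options "game fset"

fun options :: "side \<Rightarrow> game fset" where
  "options (Atom s) = {||}"
| "options (Options A) = A"

definition is_option :: "game \<Rightarrow> game \<Rightarrow> bool" where
  "is_option G' G \<longleftrightarrow> G' |\<in>| options (left_side G) \<or> G' |\<in>| options (right_side G)"

text \<open>A game counts as a follower of itself.\<close>

definition followers :: "game \<Rightarrow> game set" where
  "followers G = {K. is_option\<^sup>*\<^sup>* K G}"

definition atoms :: "game \<Rightarrow> real set" where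
  "atoms G = {s. \<exists>K\<in>followers G. left_side K = Atom s \<or> right_side K = Atom s}"

definition scoring_game :: "game \<Rightarrow> bool" where
  "scoring_game G \<longleftrightarrow>
     (\<forall>K\<in>followers G. left_side K \<noteq> Options {||} \<and> right_side K \<noteq> Options {||})"

definition guaranteed :: "game \<Rightarrow> bool" where
  "guaranteed G \<longleftrightarrow>
     (\<forall>K\<in>followers G.
        (\<forall>l. left_side K = Atom l \<longrightarrow> (\<forall>s\<in>atoms K. l \<le> s)) \<and>
        (\<forall>r. right_side K = Atom r \<longrightarrow> (\<forall>s\<in>atoms K. s \<le> r)))"

definition GS :: "game set" where
  "GS = {G. scoring_game G \<and> guaranteed G}"

lemma size_option_less: "G |\<in>| A \<Longrightarrow> size G < size (Options A)"
proof -
  assume "G |\<in>| A"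
  then have "Suc (size G) \<le> (\<Sum>x\<in>fset A. Suc (size x))"
    by (intro member_le_sum) auto
  then show ?thesis by simp
qed

lemma size_options_left: "G' |\<in>| options (left_side G) \<Longrightarrow> size G' < size G"
  by (cases G rule: game.exhaust; cases "left_side G") (auto dest!: size_option_less)

lemma size_options_right: "G' |\<in>| options (right_side G) \<Longrightarrow> size G' < size G"
  by (cases G rule: game.exhaust; cases "right_side G") (auto dest!: size_option_less)

function game_sum :: "game \<Rightarrow> game \<Rightarrow> game" where
  "game_sum G H = Game
     (case (left_side G, left_side H) of
        (Atom l1, Atom l2) \<Rightarrow> Atom (l1 + l2)
      | _ \<Rightarrow> Options ((\<lambda>G'. game_sum G' H) |`| options (left_side G) |\<union>|
                      (\<lambda>H'. game_sum G H') |`| options (left_side H)))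
     (case (right_side G, right_side H) of
        (Atom r1, Atom r2) \<Rightarrow> Atom (r1 + r2)
      | _ \<Rightarrow> Options ((\<lambda>G'. game_sum G' H) |`| options (right_side G) |\<union>|
                      (\<lambda>H'. game_sum G H') |`| options (right_side H)))"
  by auto
termination
  by (relation "measure (\<lambda>(G, H). size G + size H)")
    (auto dest: size_options_left size_options_right)

declare game_sum.simps [simp del]

instantiation game :: "{plus, zero}"
begin

definition plus_game :: "game \<Rightarrow> game \<Rightarrow> game" where
  "G + H = game_sum G H"

definition zero_game :: game where
  "0 = Game (Atom 0) (Atom 0)"

instance ..

end

function Ls :: "game \<Rightarrow> real" and Rs :: "game \<Rightarrow> real" where
  "Ls (Game (Atom l) R) = l"
| "Ls (Game (Options A) R) = Max (Rs ` fset A)"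
| "Rs (Game L (Atom r)) = r"
| "Rs (Game L (Options A)) = Min (Ls ` fset A)"
  by pat_completeness auto
termination
  by (relation "measure (case_sum size size)") (auto dest!: size_option_less)

definition game_ge :: "game \<Rightarrow> game \<Rightarrow> bool"  (infix "\<succcurlyeq>" 50) where
  "G \<succcurlyeq> H \<longleftrightarrow> (\<forall>X\<in>GS. Ls (G + X) \<ge> Ls (H + X) \<and> Rs (G + X) \<ge> Rs (H + X))"

definition game_equiv :: "game \<Rightarrow> game \<Rightarrow> bool"  (infix "\<sim>" 50) where
  "G \<sim> H \<longleftrightarrow> G \<succcurlyeq> H \<and> H \<succcurlyeq> G"

definition game_invertible :: "game \<Rightarrow> bool" where
  "game_invertible G \<longleftrightarrow> (\<exists>H\<in>GS. G + H \<sim> 0)"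

end

theory Submission
  imports Defs
begin

text \<open>
  Suppose \<open>G + H \<sim> 0\<close>, and put \<open>a = Ls G < b = Rs G\<close>. Adding a game of sufficiently many
  free waiting moves for one player leaves the stops of \<open>G + H\<close> at \<open>0\<close>, while it allows that
  player, moving second, to answer every move in the component where it was made. Hence
  \<open>Ls G + Ls H \<ge> 0 \<ge> Rs G + Rs H\<close>, so \<open>Ls H \<ge> - a > - b \<ge> Rs H\<close>. A left-atomic guaranteed game
  satisfies \<open>Ls \<le> Rs\<close>, so \<open>H\<close> has a Left option \<open>H'\<close> with \<open>Rs H' = Ls H \<ge> - a\<close>. If Left moves
  from \<open>G + H\<close> to \<open>G + H'\<close> and then answers locally, the score is at least \<open>b - a > 0\<close>.
\<close>

section \<open>Hereditary properties of followers and atoms\<close>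

lemma followers_self: "G \<in> followers G"
  by (simp add: followers_def)

lemma followers_option: "is_option G' G \<Longrightarrow> followers G' \<subseteq> followers G"
  by (auto simp: followers_def intro: rtranclp.rtrancl_into_rtrancl)

lemma atoms_option: "is_option G' G \<Longrightarrow> atoms G' \<subseteq> atoms G"
  using followers_option by (fastforce simp: atoms_def)

lemma GS_option: "is_option G' G \<Longrightarrow> G \<in> GS \<Longrightarrow> G' \<in> GS"
  using followers_option unfolding GS_def scoring_game_def guaranteed_def by blast

lemma GS_sides_nonempty:
  "G \<in> GS \<Longrightarrow> left_side G \<noteq> Options {||}"
  "G \<in> GS \<Longrightarrow> right_side G \<noteq> Options {||}"
  using followers_self unfolding GS_def scoring_game_def by blast+

lemma is_option_left: "G' |\<in>| options (left_side G) \<Longrightarrow> is_option G' G"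
  and is_option_right: "G' |\<in>| options (right_side G) \<Longrightarrow> is_option G' G"
  by (simp_all add: is_option_def)

section \<open>Stops of guaranteed games\<close>

lemma Ls_Atom: "left_side G = Atom l \<Longrightarrow> Ls G = l"
  by (cases G) auto

lemma Rs_Atom: "right_side G = Atom r \<Longrightarrow> Rs G = r"
  by (cases G) auto

lemma Rs_le_Ls: "G' |\<in>| options (left_side G) \<Longrightarrow> Rs G' \<le> Ls G"
  by (cases G; cases "left_side G") auto

lemma Rs_le_Ls_option: "G' |\<in>| options (right_side G) \<Longrightarrow> Rs G \<le> Ls G'"
  by (cases G; cases "right_side G") auto

text \<open>A finite nonempty set attains its maximum. The premise excludes the junk side, where
  \<open>Max\<close> would be taken over the empty set.\<close>

lemma Ls_cases:
  assumes "left_side G \<noteq> Options {||}"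
  obtains (Atom) l where "left_side G = Atom l" "Ls G = l"
  | (Option) G' where "G' |\<in>| options (left_side G)" "Ls G = Rs G'"
proof (cases "left_side G")
  case (Atom l)
  then show ?thesis using that(1) Ls_Atom by blast
next
  case (Options A)
  then have "Ls G = Max (Rs ` fset A)" by (cases G) auto
  moreover have "fset A \<noteq> {}" using assms Options by auto
  ultimately have "Ls G \<in> Rs ` fset A" using Max_in[of "Rs ` fset A"] by simp
  then show ?thesis using that(2) Options by auto
qed

lemma Rs_cases:
  assumes "right_side G \<noteq> Options {||}"
  obtains (Atom) r where "right_side G = Atom r" "Rs G = r"
  | (Option) G' where "G' |\<in>| options (right_side G)" "Rs G = Ls G'"
proof (cases "right_side G")
  case (Atom r)
  then show ?thesis using that(1) Rs_Atom by blast
next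
  case (Options A)
  then have "Rs G = Min (Ls ` fset A)" by (cases G) auto
  moreover have "fset A \<noteq> {}" using assms Options by auto
  ultimately have "Rs G \<in> Ls ` fset A" using Min_in[of "Ls ` fset A"] by simp
  then show ?thesis using that(2) Options by auto
qed

text \<open>Optimal play ends at an atom of some follower. This is what lets the guarantee, a
  condition on atoms, bound stops.\<close>

lemma stops_in_atoms: "G \<in> GS \<Longrightarrow> Ls G \<in> atoms G \<and> Rs G \<in> atoms G"
proof (induction "size G" arbitrary: G rule: less_induct)
  case less
  have IH: "Ls G' \<in> atoms G \<and> Rs G' \<in> atoms G" if "is_option G' G" for G'
    using less.hyps[of G'] GS_option[OF that less.prems] atoms_option[OF that] that
    by (auto simp: is_option_def dest: size_options_left size_options_right)
  have "Ls G \<in> atoms G"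
    using GS_sides_nonempty(1)[OF less.prems]
    by (cases rule: Ls_cases)
      (use followers_self[of G] IH is_option_left in \<open>auto simp: atoms_def\<close>)
  moreover have "Rs G \<in> atoms G"
    using GS_sides_nonempty(2)[OF less.prems]
    by (cases rule: Rs_cases)
      (use followers_self[of G] IH is_option_right in \<open>auto simp: atoms_def\<close>)
  ultimately show ?case ..
qed

lemma left_atom_le_Rs: "G \<in> GS \<Longrightarrow> left_side G = Atom l \<Longrightarrow> l \<le> Rs G"
  using stops_in_atoms followers_self unfolding GS_def guaranteed_def by blast

lemma Ls_le_right_atom: "G \<in> GS \<Longrightarrow> right_side G = Atom r \<Longrightarrow> Ls G \<le> r"
  using stops_in_atoms followers_self unfolding GS_def guaranteed_def by blast

section \<open>Sides of disjunctive sums\<close>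

lemma options_left_plus:
  "options (left_side (G + H)) =
     (\<lambda>G'. G' + H) |`| options (left_side G) |\<union>| (\<lambda>H'. G + H') |`| options (left_side H)"
  unfolding plus_game_def by (subst game_sum.simps) (simp split: side.split)

text \<open>As for Left, no atomic case is split off: \<open>options\<close> of an atom is empty, so
  both images vanish.\<close>

lemma options_right_plus:
  "options (right_side (G + H)) =
     (\<lambda>G'. G' + H) |`| options (right_side G) |\<union>| (\<lambda>H'. G + H') |`| options (right_side H)"
  unfolding plus_game_def by (subst game_sum.simps) (simp split: side.split)

lemma left_side_plus_eq_Atom:
  "left_side (G + H) = Atom l \<longleftrightarrow>
     (\<exists>l1 l2. left_side G = Atom l1 \<and> left_side H = Atom l2 \<and> l = l1 + l2)"
  unfolding plus_game_def by (subst game_sum.simps) (auto split: side.split)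

lemma right_side_plus_eq_Atom:
  "right_side (G + H) = Atom r \<longleftrightarrow>
     (\<exists>r1 r2. right_side G = Atom r1 \<and> right_side H = Atom r2 \<and> r = r1 + r2)"
  unfolding plus_game_def by (subst game_sum.simps) (auto split: side.split)

lemma left_side_plus_nonempty:
  "left_side G \<noteq> Options {||} \<Longrightarrow> left_side H \<noteq> Options {||} \<Longrightarrow>
     left_side (G + H) \<noteq> Options {||}"
  unfolding plus_game_def by (subst game_sum.simps) (auto split: side.split)

lemma right_side_plus_nonempty:
  "right_side G \<noteq> Options {||} \<Longrightarrow> right_side H \<noteq> Options {||} \<Longrightarrow>
     right_side (G + H) \<noteq> Options {||}"
  unfolding plus_game_def by (subst game_sum.simps) (auto split: side.split)

section \<open>Waiting games\<close>

primrec left_wait :: "nat \<Rightarrow> game" where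
  "left_wait 0 = Game (Atom 0) (Atom 0)"
| "left_wait (Suc n) = Game (Options {|left_wait n|}) (Atom 0)"

text \<open>Both families give one player \<open>n\<close> free moves and the other player none. All
  atoms are 0, so waiting never changes the score.\<close>

primrec right_wait :: "nat \<Rightarrow> game" where
  "right_wait 0 = Game (Atom 0) (Atom 0)"
| "right_wait (Suc n) = Game (Atom 0) (Options {|right_wait n|})"

lemma right_side_left_wait [simp]: "right_side (left_wait n) = Atom 0"
  by (cases n) auto

lemma left_side_right_wait [simp]: "left_side (right_wait n) = Atom 0"
  by (cases n) auto

lemma follower_induct:
  assumes "K \<in> followers G" "P G" "\<And>K K'. P K \<Longrightarrow> is_option K' K \<Longrightarrow> P K'"
  shows "P K"
proof -
  have "is_option\<^sup>*\<^sup>* K G" using assms(1) by (simp add: followers_def)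
  then show ?thesis
    by (induction rule: converse_rtranclp_induct) (use assms(2,3) in blast)+
qed

text \<open>When all atoms are 0, each inequality in the guarantee reads 0 \<le> 0. The predicate
  \<open>P\<close> is an invariant passed from a game to its options, hence to all
  followers.\<close>

lemma GS_zero_atomsI:
  assumes "P G"
    and hered: "\<And>K K'. P K \<Longrightarrow> is_option K' K \<Longrightarrow> P K'"
    and nonempty: "\<And>K. P K \<Longrightarrow> left_side K \<noteq> Options {||} \<and> right_side K \<noteq> Options {||}"
    and zero: "\<And>K s. P K \<Longrightarrow> left_side K = Atom s \<or> right_side K = Atom s \<Longrightarrow> s = 0"
  shows "G \<in> GS"
proof -
  have P: "P K'" if "P K" "K' \<in> followers K" for K K'
    using that(2,1) hered by (rule follower_induct)
  then have "s = 0" if "P K" "s \<in> atoms K" for K s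
    using that zero unfolding atoms_def by blast
  then have "guaranteed G"
    using P[OF assms(1)] zero unfolding guaranteed_def by (metis order_refl)
  moreover have "scoring_game G"
    using P[OF assms(1)] nonempty unfolding scoring_game_def by blast
  ultimately show ?thesis by (simp add: GS_def)
qed

lemma left_wait_GS: "left_wait n \<in> GS"
proof (rule GS_zero_atomsI[where P = "\<lambda>K. \<exists>m. K = left_wait m"])
  fix K K' assume "\<exists>m. K = left_wait m" "is_option K' K"
  then obtain m where "is_option K' (left_wait m)" by blast
  then show "\<exists>m. K' = left_wait m" by (cases m) (auto simp: is_option_def)
next
  fix K assume "\<exists>m. K = left_wait m"
  then obtain m where "K = left_wait m" by blast
  then show "left_side K \<noteq> Options {||} \<and> right_side K \<noteq> Options {||}" by (cases m) auto
next
  fix K s assume "\<exists>m. K = left_wait m" "left_side K = Atom s \<or> right_side K = Atom s"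
  then obtain m where "left_side (left_wait m) = Atom s \<or> right_side (left_wait m) = Atom s"
    by blast
  then show "s = 0" by (cases m) auto
qed blast

lemma right_wait_GS: "right_wait n \<in> GS"
proof (rule GS_zero_atomsI[where P = "\<lambda>K. \<exists>m. K = right_wait m"])
  fix K K' assume "\<exists>m. K = right_wait m" "is_option K' K"
  then obtain m where "is_option K' (right_wait m)" by blast
  then show "\<exists>m. K' = right_wait m" by (cases m) (auto simp: is_option_def)
next
  fix K assume "\<exists>m. K = right_wait m"
  then obtain m where "K = right_wait m" by blast
  then show "left_side K \<noteq> Options {||} \<and> right_side K \<noteq> Options {||}" by (cases m) auto
next
  fix K s assume "\<exists>m. K = right_wait m" "left_side K = Atom s \<or> right_side K = Atom s"
  then obtain m where "left_side (right_wait m) = Atom s \<or> right_side (right_wait m) = Atom s"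
    by blast
  then show "s = 0" by (cases m) auto
qed blast

section \<open>Bounds on the stops of a sum with waiting moves\<close>

text \<open>
  Left's reply to a Right move \<open>G \<rightarrow> G'\<close> is a best local one, or a waiting move if \<open>G'\<close> is
  left-atomic; the latter costs nothing because \<open>Ls G' \<le> Rs G'\<close>.
\<close>

lemma Rs_plus_left_wait_ge:
  assumes "G \<in> GS" "H \<in> GS" "size G + size H \<le> n"
  shows "Rs G + Rs H \<le> Rs (G + H + left_wait n)"
  using assms
proof (induction "size G + size H" arbitrary: G H n rule: less_induct)
  case less
  have nonempty: "right_side (G + H + left_wait n) \<noteq> Options {||}"
    using GS_sides_nonempty less.prems by (intro right_side_plus_nonempty) auto
  have moveG: "Rs G + Rs H \<le> Ls (G' + H + left_wait n)"
    if G': "G' |\<in>| options (right_side G)" for G'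
  proof -
    note sz = size_options_right[OF G']
    have GS': "G' \<in> GS" using GS_option[OF is_option_right[OF G'] less.prems(1)] .
    show ?thesis
      using GS_sides_nonempty(1)[OF GS']
    proof (cases rule: Ls_cases)
      case (Atom l)
      \<comment> \<open>Right's move has shrunk \<open>G\<close>, so the size bound gives n > 0, and
        \<open>m\<close> waits still suffice for \<open>G'\<close> and \<open>H\<close>.\<close>
      obtain m where m: "n = Suc m" using less.prems(3) sz by (cases n) auto
      have "Rs G' + Rs H \<le> Rs (G' + H + left_wait m)"
        using less.hyps[of G' H m] sz GS' less.prems m by auto
      also have "\<dots> \<le> Ls (G' + H + left_wait n)"
        by (rule Rs_le_Ls) (simp add: options_left_plus m)
      \<comment> \<open>Here Rs G \<le> Ls G' = l \<le> Rs G', the last step by the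
        guarantee.\<close>
      finally show ?thesis
        using left_atom_le_Rs[OF GS' Atom(1)] Atom(2) Rs_le_Ls_option[OF G'] by linarith
    next
      case (Option G'')
      note sz' = size_options_left[OF Option(1)]
      have GS'': "G'' \<in> GS" using GS_option[OF is_option_left[OF Option(1)] GS'] .
      have "Rs G'' + Rs H \<le> Rs (G'' + H + left_wait n)"
        using less.hyps[of G'' H n] sz sz' GS'' less.prems by auto
      also have "\<dots> \<le> Ls (G' + H + left_wait n)"
        by (rule Rs_le_Ls) (use Option(1) in \<open>auto simp: options_left_plus\<close>)
      finally show ?thesis using Option(2) Rs_le_Ls_option[OF G'] by linarith
    qed
  qed
  have moveH: "Rs G + Rs H \<le> Ls (G + H' + left_wait n)"
    if H': "H' |\<in>| options (right_side H)" for H'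
  proof -
    note sz = size_options_right[OF H']
    have GS': "H' \<in> GS" using GS_option[OF is_option_right[OF H'] less.prems(2)] .
    show ?thesis
      using GS_sides_nonempty(1)[OF GS']
    proof (cases rule: Ls_cases)
      case (Atom l)
      obtain m where m: "n = Suc m" using less.prems(3) sz by (cases n) auto
      have "Rs G + Rs H' \<le> Rs (G + H' + left_wait m)"
        using less.hyps[of G H' m] sz GS' less.prems m by auto
      also have "\<dots> \<le> Ls (G + H' + left_wait n)"
        by (rule Rs_le_Ls) (simp add: options_left_plus m)
      finally show ?thesis
        using left_atom_le_Rs[OF GS' Atom(1)] Atom(2) Rs_le_Ls_option[OF H'] by linarith
    next
      case (Option H'')
      note sz' = size_options_left[OF Option(1)]
      have GS'': "H'' \<in> GS" using GS_option[OF is_option_left[OF Option(1)] GS'] .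
      have "Rs G + Rs H'' \<le> Rs (G + H'' + left_wait n)"
        using less.hyps[of G H'' n] sz sz' GS'' less.prems by auto
      also have "\<dots> \<le> Ls (G + H' + left_wait n)"
        by (rule Rs_le_Ls) (use Option(1) in \<open>auto simp: options_left_plus\<close>)
      finally show ?thesis using Option(2) Rs_le_Ls_option[OF H'] by linarith
    qed
  qed
  show ?case
    using nonempty
  proof (cases rule: Rs_cases)
    case (Atom r)
    then show ?thesis by (auto simp: right_side_plus_eq_Atom Rs_Atom)
  next
    \<comment> \<open>Right has no option in \<open>left_wait n\<close>, so \<open>K\<close> comes
      from a move in \<open>G\<close> or in \<open>H\<close>.\<close>
    case (Option K)
    then show ?thesis using moveG moveH by (auto simp: options_right_plus)
  qed
qed

text \<open>The mirror image with the players exchanged: Right answers locally, or waits when Left's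
  move leads to a right-atomic game, whose Ls is at most its Rs.\<close>

lemma Ls_plus_right_wait_le:
  assumes "G \<in> GS" "H \<in> GS" "size G + size H \<le> n"
  shows "Ls (G + H + right_wait n) \<le> Ls G + Ls H"
  using assms
proof (induction "size G + size H" arbitrary: G H n rule: less_induct)
  case less
  have nonempty: "left_side (G + H + right_wait n) \<noteq> Options {||}"
    using GS_sides_nonempty less.prems by (intro left_side_plus_nonempty) auto
  have moveG: "Rs (G' + H + right_wait n) \<le> Ls G + Ls H"
    if G': "G' |\<in>| options (left_side G)" for G'
  proof -
    note sz = size_options_left[OF G']
    have GS': "G' \<in> GS" using GS_option[OF is_option_left[OF G'] less.prems(1)] .
    show ?thesis
      using GS_sides_nonempty(2)[OF GS']
    proof (cases rule: Rs_cases)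
      case (Atom r)
      obtain m where m: "n = Suc m" using less.prems(3) sz by (cases n) auto
      have "Rs (G' + H + right_wait n) \<le> Ls (G' + H + right_wait m)"
        by (rule Rs_le_Ls_option) (simp add: options_right_plus m)
      also have "\<dots> \<le> Ls G' + Ls H"
        using less.hyps[of G' H m] sz GS' less.prems m by auto
      finally show ?thesis
        using Ls_le_right_atom[OF GS' Atom(1)] Atom(2) Rs_le_Ls[OF G'] by linarith
    next
      case (Option G'')
      note sz' = size_options_right[OF Option(1)]
      have GS'': "G'' \<in> GS" using GS_option[OF is_option_right[OF Option(1)] GS'] .
      have "Rs (G' + H + right_wait n) \<le> Ls (G'' + H + right_wait n)"
        by (rule Rs_le_Ls_option) (use Option(1) in \<open>auto simp: options_right_plus\<close>)
      also have "\<dots> \<le> Ls G'' + Ls H"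
        using less.hyps[of G'' H n] sz sz' GS'' less.prems by auto
      finally show ?thesis using Option(2) Rs_le_Ls[OF G'] by linarith
    qed
  qed
  have moveH: "Rs (G + H' + right_wait n) \<le> Ls G + Ls H"
    if H': "H' |\<in>| options (left_side H)" for H'
  proof -
    note sz = size_options_left[OF H']
    have GS': "H' \<in> GS" using GS_option[OF is_option_left[OF H'] less.prems(2)] .
    show ?thesis
      using GS_sides_nonempty(2)[OF GS']
    proof (cases rule: Rs_cases)
      case (Atom r)
      obtain m where m: "n = Suc m" using less.prems(3) sz by (cases n) auto
      have "Rs (G + H' + right_wait n) \<le> Ls (G + H' + right_wait m)"
        by (rule Rs_le_Ls_option) (simp add: options_right_plus m)
      also have "\<dots> \<le> Ls G + Ls H'"
        using less.hyps[of G H' m] sz GS' less.prems m by auto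
      finally show ?thesis
        using Ls_le_right_atom[OF GS' Atom(1)] Atom(2) Rs_le_Ls[OF H'] by linarith
    next
      case (Option H'')
      note sz' = size_options_right[OF Option(1)]
      have GS'': "H'' \<in> GS" using GS_option[OF is_option_right[OF Option(1)] GS'] .
      have "Rs (G + H' + right_wait n) \<le> Ls (G + H'' + right_wait n)"
        by (rule Rs_le_Ls_option) (use Option(1) in \<open>auto simp: options_right_plus\<close>)
      also have "\<dots> \<le> Ls G + Ls H''"
        using less.hyps[of G H'' n] sz sz' GS'' less.prems by auto
      finally show ?thesis using Option(2) Rs_le_Ls[OF H'] by linarith
    qed
  qed
  show ?case
    using nonempty
  proof (cases rule: Ls_cases)
    case (Atom l)
    then show ?thesis by (auto simp: left_side_plus_eq_Atom Ls_Atom)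
  next
    case (Option K)
    then show ?thesis using moveG moveH by (auto simp: options_left_plus)
  qed
qed

section \<open>Stops of waiting games alone, and the contradiction\<close>

lemma Ls_zero_plus_right_wait: "Ls (0 + right_wait n) = 0"
  by (rule Ls_Atom) (simp add: left_side_plus_eq_Atom zero_game_def)

lemma Rs_zero_plus_left_wait: "Rs (0 + left_wait n) = 0"
  by (rule Rs_Atom) (simp add: right_side_plus_eq_Atom zero_game_def)

text \<open>Left can at most spend one wait; Right is then to move on the atom 0.\<close>

lemma Ls_zero_plus_left_wait: "Ls (0 + left_wait n) = 0"
proof -
  have "left_side (0 + left_wait n) \<noteq> Options {||}"
    using GS_sides_nonempty(1)[OF left_wait_GS]
    by (intro left_side_plus_nonempty) (auto simp: zero_game_def)
  then show ?thesis
  proof (cases rule: Ls_cases)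
    case (Atom l)
    then show ?thesis by (cases n) (auto simp: left_side_plus_eq_Atom zero_game_def)
  next
    case (Option K)
    then have "\<exists>m. K = 0 + left_wait m"
      by (cases n) (auto simp: options_left_plus, auto simp: zero_game_def)
    then show ?thesis using Option(2) Rs_zero_plus_left_wait by auto
  qed
qed

theorem theorem46:
  fixes G :: game
  assumes "G \<in> GS" and "Ls G < Rs G"
  shows "\<not> game_invertible G"
proof
  assume "game_invertible G"
  then obtain H where H: "H \<in> GS" and equiv: "G + H \<sim> 0"
    by (auto simp: game_invertible_def)
  define n where "n = size G + size H"
  have "Ls (G + H + right_wait n) = 0"
    using equiv right_wait_GS[of n] Ls_zero_plus_right_wait[of n]
    unfolding game_equiv_def game_ge_def by (metis order_antisym)
  then have Ls_H: "- Ls G \<le> Ls H"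
    using Ls_plus_right_wait_le[OF assms(1) H, of n] by (simp add: n_def)
  have "Rs (G + H + left_wait n) = 0"
    using equiv left_wait_GS[of n] Rs_zero_plus_left_wait[of n]
    unfolding game_equiv_def game_ge_def by (metis order_antisym)
  then have Rs_H: "Rs H \<le> - Rs G"
    using Rs_plus_left_wait_ge[OF assms(1) H, of n] by (simp add: n_def)
  show False
    using GS_sides_nonempty(1)[OF H]
  proof (cases rule: Ls_cases)
    \<comment> \<open>The guarantee gives Ls H \<le> Rs H, against Rs H \<le> - Rs G < - Ls G \<le>
      Ls H.\<close>
    case (Atom l)
    then show ?thesis using left_atom_le_Rs[OF H Atom(1)] Ls_H Rs_H assms(2) by linarith
  next
    case (Option H')
    have "H' \<in> GS" using GS_option[OF is_option_left[OF Option(1)] H] .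
    \<comment> \<open>The same \<open>n\<close> is large enough, since \<open>H'\<close> is smaller
      than \<open>H\<close>.\<close>
    then have "Rs G + Rs H' \<le> Rs (G + H' + left_wait n)"
      using size_options_left[OF Option(1)] assms(1)
      by (intro Rs_plus_left_wait_ge) (auto simp: n_def)
    also have "\<dots> \<le> Ls (G + H + left_wait n)"
      by (rule Rs_le_Ls) (use Option(1) in \<open>auto simp: options_left_plus\<close>)
    \<comment> \<open>The equivalence is used a third time, now with Left starting and also holding
      the waits.\<close>
    also have "\<dots> = 0"
      using equiv left_wait_GS[of n] Ls_zero_plus_left_wait[of n]
      unfolding game_equiv_def game_ge_def by (metis order_antisym)
    \<comment> \<open>Since Rs H' = Ls H \<ge> - Ls G, the chain yields Rs G - Ls G \<le> 0.\<close>
    finally show ?thesis using Option(2) Ls_H assms(2) by linarith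
  qed
qed

end
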